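(* For every $A\in\mathrm{Form}$ the following are equivalent: (i) $\Vvdash^V_{\mathcal G}A$; (ii) $\Vdash^V_{I_G}A$ for all $G\in\mathcal G$; (iii) $A$ is a theorem of intuitionistic propositional logic ($\vdash_{\mathbf{IPC}}A$).
   Context: Formulas: $\mathrm{Var}$ is a countable set of variables; $\mathrm{Form}$ is generated from $\bot$ and $\mathrm{Var}$ by $\land,\lor,\to$; $\neg A$ abbreviates $A\to\bot$. An intuitionistic frame is a nonempty partially ordered set; all frames are rooted and tree-like (there is a least element, and for each element the set of elements below it is a finite chain). An intuitionistic model $\langle K,\le,v\rangle$ adds $v:\mathrm{Var}\to\mathcal P(K)$ with each $v(p)$ closed upwards; $\Vdash_I$ denotes the usual intuitionistic Kripke forcing relation of an intuitionistic model $I$. A finite strict finitistic model is an intuitionistic model $W=\langle K_W,\le_W,v_W\rangle$ with $K_W$ finite such that for each $k\in K_W$ the set $\{p: k\in v_W(p)\}$ is finite, and for every $p$, if $v_W(p)\ne\emptyset$ then for every $l\in K_W$ there is $l'\ge_W l$ with $l'\in v_W(p)$. $\mathcal W_{\mathrm{fin}}$ is the class of these models. Generation structures: let $\mathcal U\subseteq\mathcal W_{\mathrm{fin}}$ be at most countable. A relation $\preceq$ on $\mathcal U$ is a generation order if $W_1\preceq W_2$ holds iff (a) $K_{W_1}\subseteq K_{W_2}$, (b) for all $k,k'\in K_{W_1}$, $k\le_{W_1}k'$ iff $k\le_{W_2}k'$, and (c) $v_{W_1}(p)\subseteq v_{W_2}(p)$ for all $p$. $\langle\mathcal U,\preceq\rangle$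 is a generation structure if $\preceq$ is a generation order and $\langle\mathcal U,\preceq\rangle$ is a (rooted tree-like) intuitionistic frame. $\mathcal G$ is the class of all generation structures. Generation forcing for $G=\langle\mathcal U,\preceq\rangle\in\mathcal G$, $W\in\mathcal U$, $k\in K_W$: $W,k\Vvdash_G p$ iff $k\in v_W(p)$; $W,k\not\Vvdash_G\bot$; $W,k\Vvdash_G A\land B$ iff $W,k\Vvdash_G A$ and $W,k\Vvdash_G B$; $W,k\Vvdash_G A\lor B$ iff $W,k\Vvdash_G A$ or $W,k\Vvdash_G B$; $W,k\Vvdash_G A\to B$ iff for every $W'\succeq W$ and $k'\in K_{W'}$ with $k'\ge_{W'}k$, if $W',k'\Vvdash_G A$ then there is $k''\in K_{W'}$ with $k''\ge_{W'}k'$ and $W',k''\Vvdash_G B$. $\Vvdash^V_{\mathcal G}A$ means: for all $G=\langle\mathcal U,\preceq\rangle\in\mathcal G$, all $W\in\mathcal U$ and all $k\in K_W$, $W,k\Vvdash_G A$. Induced intuitionistic model: $I_G=\langle\mathcal U,\preceq,v\rangle$, where $W\in v(p)$ iff there is $k\in K_W$ with $W,k\Vvdash_G p$. $\Vdash^V_{I_G}A$ means $W\Vdash_{I_G}A$ for all $W\in\mathcal U$. *)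

theory Defs
  imports "HOL-Library.Countable_Set"
begin

datatype 'v form =
    Var 'v
  | Bot (\<open>\<^bold>\<bottom>\<close>)
  | And "'v form" "'v form" (infixr \<open>\<^bold>\<and>\<close> 65)
  | Or "'v form" "'v form" (infixr \<open>\<^bold>\<or>\<close> 60)
  | Imp "'v form" "'v form" (infixr \<open>\<^bold>\<rightarrow>\<close> 55)

abbreviation Neg :: "'v form \<Rightarrow> 'v form" where
  "Neg A \<equiv> A \<^bold>\<rightarrow> \<^bold>\<bottom>"


section \<open>Intuitionistic propositional logic\<close>

inductive IPC :: "'v form \<Rightarrow> bool" (\<open>\<turnstile>\<^sub>I\<^sub>P\<^sub>C _\<close> [50] 50) where
  K: "\<turnstile>\<^sub>I\<^sub>P\<^sub>C A \<^bold>\<rightarrow> B \<^bold>\<rightarrow> A"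
| S: "\<turnstile>\<^sub>I\<^sub>P\<^sub>C (A \<^bold>\<rightarrow> B \<^bold>\<rightarrow> C) \<^bold>\<rightarrow> (A \<^bold>\<rightarrow> B) \<^bold>\<rightarrow> A \<^bold>\<rightarrow> C"
| AndI: "\<turnstile>\<^sub>I\<^sub>P\<^sub>C A \<^bold>\<rightarrow> B \<^bold>\<rightarrow> A \<^bold>\<and> B"
| AndE1: "\<turnstile>\<^sub>I\<^sub>P\<^sub>C A \<^bold>\<and> B \<^bold>\<rightarrow> A"
| AndE2: "\<turnstile>\<^sub>I\<^sub>P\<^sub>C A \<^bold>\<and> B \<^bold>\<rightarrow> B"
| OrI1: "\<turnstile>\<^sub>I\<^sub>P\<^sub>C A \<^bold>\<rightarrow> A \<^bold>\<or> B"
| OrI2: "\<turnstile>\<^sub>I\<^sub>P\<^sub>C B \<^bold>\<rightarrow> A \<^bold>\<or> B"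
| OrE: "\<turnstile>\<^sub>I\<^sub>P\<^sub>C (A \<^bold>\<rightarrow> C) \<^bold>\<rightarrow> (B \<^bold>\<rightarrow> C) \<^bold>\<rightarrow> A \<^bold>\<or> B \<^bold>\<rightarrow> C"
| BotE: "\<turnstile>\<^sub>I\<^sub>P\<^sub>C \<^bold>\<bottom> \<^bold>\<rightarrow> A"
| MP: "\<turnstile>\<^sub>I\<^sub>P\<^sub>C A \<^bold>\<rightarrow> B \<Longrightarrow> \<turnstile>\<^sub>I\<^sub>P\<^sub>C A \<Longrightarrow> \<turnstile>\<^sub>I\<^sub>P\<^sub>C B"


section \<open>Intuitionistic frames and models\<close>

record 'a frame =
  worlds :: "'a set"
  le :: "('a \<times> 'a) set"

record ('a, 'v) model = "'a frame" +
  val :: "'v \<Rightarrow> 'a set"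

text \<open>All frames are rooted and tree-like.  Since \<^const>\<open>partial_order_on\<close> and
  \<open>int_model\<close> confine the order and the valuation to the carrier, two models are equal as soon as
  they have the same worlds, the same order on them, and the same valuation; this is what makes
  antisymmetry of the generation order below meaningful.\<close>

definition int_frame :: "('a, 'b) frame_scheme \<Rightarrow> bool" where
  "int_frame F \<longleftrightarrow>
     worlds F \<noteq> {} \<and>
     partial_order_on (worlds F) (le F) \<and>
     (\<exists>r\<in>worlds F. \<forall>k\<in>worlds F. (r, k) \<in> le F) \<and>
     (\<forall>k\<in>worlds F. finite {l \<in> worlds F. (l, k) \<in> le F} \<and>
                   {l \<in> worlds F. (l, k) \<in> le F} \<in> Chains (le F))"

definition int_model :: "('a, 'v) model \<Rightarrow> bool" where
  "int_model M \<longleftrightarrow>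
     int_frame M \<and>
     (\<forall>p. val M p \<subseteq> worlds M) \<and>
     (\<forall>p k k'. k \<in> val M p \<longrightarrow> (k, k') \<in> le M \<longrightarrow> k' \<in> val M p)"

primrec int_forces :: "('a, 'v) model \<Rightarrow> 'a \<Rightarrow> 'v form \<Rightarrow> bool" where
  "int_forces M k (Var p) \<longleftrightarrow> k \<in> val M p"
| "int_forces M k \<^bold>\<bottom> \<longleftrightarrow> False"
| "int_forces M k (A \<^bold>\<and> B) \<longleftrightarrow> int_forces M k A \<and> int_forces M k B"
| "int_forces M k (A \<^bold>\<or> B) \<longleftrightarrow> int_forces M k A \<or> int_forces M k B"
| "int_forces M k (A \<^bold>\<rightarrow> B) \<longleftrightarrow>
     (\<forall>k'\<in>worlds M. (k, k') \<in> le M \<longrightarrow> int_forces M k' A \<longrightarrow> int_forces M k' B)"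

definition int_valid :: "('a, 'v) model \<Rightarrow> 'v form \<Rightarrow> bool" where
  "int_valid M A \<longleftrightarrow> (\<forall>k\<in>worlds M. int_forces M k A)"


section \<open>Finite strict finitistic models\<close>

definition fin_sf_models :: "('w, 'v) model set" where
  "fin_sf_models =
     {W. int_model W \<and>
         finite (worlds W) \<and>
         (\<forall>k\<in>worlds W. finite {p. k \<in> val W p}) \<and>
         (\<forall>p. val W p \<noteq> {} \<longrightarrow>
              (\<forall>l\<in>worlds W. \<exists>l'\<in>worlds W. (l, l') \<in> le W \<and> l' \<in> val W p))}"


section \<open>Generation structures\<close>

text \<open>The worlds are drawn from a type \<open>'w\<close>.  A generation structure involves at most
  countably many worlds altogether, so that, up to renaming of worlds, every infinite \<open>'w\<close> carries
  all generation structures.\<close>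

definition generation_order :: "('w, 'v) model frame \<Rightarrow> bool" where
  "generation_order G \<longleftrightarrow>
     (\<forall>W1\<in>worlds G. \<forall>W2\<in>worlds G. (W1, W2) \<in> le G \<longleftrightarrow>
        worlds W1 \<subseteq> worlds W2 \<and>
        (\<forall>k\<in>worlds W1. \<forall>k'\<in>worlds W1. (k, k') \<in> le W1 \<longleftrightarrow> (k, k') \<in> le W2) \<and>
        (\<forall>p. val W1 p \<subseteq> val W2 p))"

definition generation_structures :: "('w, 'v) model frame set" where
  "generation_structures =
     {G. worlds G \<subseteq> fin_sf_models \<and> countable (worlds G) \<and>
         generation_order G \<and> int_frame G}"

primrec gen_forces ::
    "('w, 'v) model frame \<Rightarrow> ('w, 'v) model \<Rightarrow> 'w \<Rightarrow> 'v form \<Rightarrow> bool" where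
  "gen_forces G W k (Var p) \<longleftrightarrow> k \<in> val W p"
| "gen_forces G W k \<^bold>\<bottom> \<longleftrightarrow> False"
| "gen_forces G W k (A \<^bold>\<and> B) \<longleftrightarrow> gen_forces G W k A \<and> gen_forces G W k B"
| "gen_forces G W k (A \<^bold>\<or> B) \<longleftrightarrow> gen_forces G W k A \<or> gen_forces G W k B"
| "gen_forces G W k (A \<^bold>\<rightarrow> B) \<longleftrightarrow>
     (\<forall>W'\<in>worlds G. (W, W') \<in> le G \<longrightarrow>
       (\<forall>k'\<in>worlds W'. (k, k') \<in> le W' \<longrightarrow> gen_forces G W' k' A \<longrightarrow>
         (\<exists>k''\<in>worlds W'. (k', k'') \<in> le W' \<and> gen_forces G W' k'' B)))"

definition gen_valid :: "('w, 'v) model frame set \<Rightarrow> 'v form \<Rightarrow> bool" where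
  "gen_valid \<G> A \<longleftrightarrow> (\<forall>G\<in>\<G>. \<forall>W\<in>worlds G. \<forall>k\<in>worlds W. gen_forces G W k A)"

definition induced_model :: "('w, 'v) model frame \<Rightarrow> (('w, 'v) model, 'v) model" where
  "induced_model G =
     \<lparr>worlds = worlds G, le = le G,
      val = (\<lambda>p. {W \<in> worlds G. \<exists>k\<in>worlds W. gen_forces G W k (Var p)})\<rparr>"

end

theory Submission
  imports Defs "HOL-Library.Sublist"
begin

text \<open>In a generation structure a formula forced at one world of \<open>W\<close> is forced cofinally in \<open>W\<close>, so
  "forced somewhere in \<open>W\<close>" coincides with intuitionistic forcing in the induced model, and an
  implication is forced at one world of \<open>W\<close> iff it is forced at all of them.  Soundness of
  intuitionistic logic thus gives validity of its theorems in the induced models; to obtain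
  forcing at every world, descend through the theorem, using the disjunction property
  (Kleene's slash) for disjunctions.

  Conversely, an unprovable formula fails in a countable tree, the unravelling of the finite
  canonical model on its subformulas.  Every countable tree model (with finitely many variables
  true at each node) is the induced model of a generation structure: to a node \<open>t\<close> assign the
  chain of nodes below \<open>t\<close>, with the variables true at \<open>t\<close> true throughout the chain.\<close>

section \<open>Derivability from assumptions\<close>

text \<open>Theorems of IPC enter as leaves and modus ponens is the only rule, so the deduction
  theorem reduces to the axioms \<open>K\<close> and \<open>S\<close>, and every other rule comes
  from one axiom.\<close>

inductive derives :: "'v form set \<Rightarrow> 'v form \<Rightarrow> bool" (infix \<open>\<turnstile>\<close> 50) for \<Gamma> where
  assm: "A \<in> \<Gamma> \<Longrightarrow> \<Gamma> \<turnstile> A"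
| ipc: "\<turnstile>\<^sub>I\<^sub>P\<^sub>C A \<Longrightarrow> \<Gamma> \<turnstile> A"
| mp: "\<Gamma> \<turnstile> A \<^bold>\<rightarrow> B \<Longrightarrow> \<Gamma> \<turnstile> A \<Longrightarrow> \<Gamma> \<turnstile> B"

lemma derives_empty_iff: "{} \<turnstile> A \<longleftrightarrow> \<turnstile>\<^sub>I\<^sub>P\<^sub>C A"
proof
  show "{} \<turnstile> A \<Longrightarrow> \<turnstile>\<^sub>I\<^sub>P\<^sub>C A"
    by (induction rule: derives.induct) (auto intro: IPC.MP)
qed (rule ipc)

lemma derives_Imp_weaken: "\<Gamma> \<turnstile> B \<Longrightarrow> \<Gamma> \<turnstile> A \<^bold>\<rightarrow> B"
  by (meson IPC.K mp ipc)

lemma derives_Imp_refl: "\<Gamma> \<turnstile> A \<^bold>\<rightarrow> A"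
  by (meson IPC.K IPC.S mp ipc)

lemma deduction: "insert A \<Gamma> \<turnstile> B \<Longrightarrow> \<Gamma> \<turnstile> A \<^bold>\<rightarrow> B"
proof (induction rule: derives.induct)
  case (assm B)
  then show ?case
    by (auto intro: derives_Imp_refl derives_Imp_weaken derives.assm)
next
  case (ipc B)
  then show ?case
    by (blast intro: derives_Imp_weaken derives.ipc)
next
  case (mp B C)
  have "\<Gamma> \<turnstile> (A \<^bold>\<rightarrow> B \<^bold>\<rightarrow> C) \<^bold>\<rightarrow> (A \<^bold>\<rightarrow> B) \<^bold>\<rightarrow> A \<^bold>\<rightarrow> C"
    by (intro derives.ipc IPC.S)
  with mp.IH show ?case
    by (blast intro: derives.mp)
qed

lemma derives_cut: "insert A \<Gamma> \<turnstile> B \<Longrightarrow> \<Gamma> \<turnstile> A \<Longrightarrow> \<Gamma> \<turnstile> B"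
  by (blast intro: mp deduction)

lemma derives_AndI: "\<Gamma> \<turnstile> A \<Longrightarrow> \<Gamma> \<turnstile> B \<Longrightarrow> \<Gamma> \<turnstile> A \<^bold>\<and> B"
  by (meson IPC.AndI mp ipc)

lemma derives_AndE1: "\<Gamma> \<turnstile> A \<^bold>\<and> B \<Longrightarrow> \<Gamma> \<turnstile> A"
  by (meson IPC.AndE1 mp ipc)

lemma derives_AndE2: "\<Gamma> \<turnstile> A \<^bold>\<and> B \<Longrightarrow> \<Gamma> \<turnstile> B"
  by (meson IPC.AndE2 mp ipc)

lemma derives_OrI1: "\<Gamma> \<turnstile> A \<Longrightarrow> \<Gamma> \<turnstile> A \<^bold>\<or> B"
  by (meson IPC.OrI1 mp ipc)

lemma derives_OrI2: "\<Gamma> \<turnstile> B \<Longrightarrow> \<Gamma> \<turnstile> A \<^bold>\<or> B"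
  by (meson IPC.OrI2 mp ipc)

lemma derives_OrE:
  assumes "\<Gamma> \<turnstile> A \<^bold>\<or> B" "insert A \<Gamma> \<turnstile> C" "insert B \<Gamma> \<turnstile> C"
  shows "\<Gamma> \<turnstile> C"
proof -
  have "\<Gamma> \<turnstile> (A \<^bold>\<rightarrow> C) \<^bold>\<rightarrow> (B \<^bold>\<rightarrow> C) \<^bold>\<rightarrow> A \<^bold>\<or> B \<^bold>\<rightarrow> C"
    by (intro ipc IPC.OrE)
  then show ?thesis
    using mp deduction assms by metis
qed

lemma derives_And_iff: "\<Gamma> \<turnstile> A \<^bold>\<and> B \<longleftrightarrow> \<Gamma> \<turnstile> A \<and> \<Gamma> \<turnstile> B"
  using derives_AndI derives_AndE1 derives_AndE2 by blast

lemma derives_BotE: "\<Gamma> \<turnstile> \<^bold>\<bottom> \<Longrightarrow> \<Gamma> \<turnstile> A"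
  by (meson IPC.BotE mp ipc)


section \<open>The disjunction property\<close>

text \<open>Kleene's slash without assumptions, in the variant that pairs it with provability in
  disjuncts and in antecedents. Besides the disjunction property it shows that neither a variable
  nor falsum is a theorem.\<close>

primrec slash :: "'v form \<Rightarrow> bool" where
  "slash (Var p) \<longleftrightarrow> False"
| "slash \<^bold>\<bottom> \<longleftrightarrow> False"
| "slash (A \<^bold>\<and> B) \<longleftrightarrow> slash A \<and> slash B"
| "slash (A \<^bold>\<or> B) \<longleftrightarrow> (\<turnstile>\<^sub>I\<^sub>P\<^sub>C A) \<and> slash A \<or> (\<turnstile>\<^sub>I\<^sub>P\<^sub>C B) \<and> slash B"
| "slash (A \<^bold>\<rightarrow> B) \<longleftrightarrow> ((\<turnstile>\<^sub>I\<^sub>P\<^sub>C A) \<and> slash A \<longrightarrow> slash B)"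

text \<open>Every axiom is slashed and modus ponens preserves the slash. The provability conjuncts
  do their work here: \<open>OrI1\<close> and \<open>OrI2\<close> can only be slashed because a
  provable antecedent makes the disjunct provable.\<close>

lemma IPC_imp_slash: "\<turnstile>\<^sub>I\<^sub>P\<^sub>C A \<Longrightarrow> slash A"
  by (induction rule: IPC.induct) (auto intro: IPC.MP)

lemma IPC_disjunction_property: "\<turnstile>\<^sub>I\<^sub>P\<^sub>C A \<^bold>\<or> B \<Longrightarrow> (\<turnstile>\<^sub>I\<^sub>P\<^sub>C A) \<or> (\<turnstile>\<^sub>I\<^sub>P\<^sub>C B)"
  using IPC_imp_slash by fastforce


section \<open>Intuitionistic Kripke models\<close>

lemma int_frame_order:
  assumes "int_frame F"
  shows le_refl: "k \<in> worlds F \<Longrightarrow> (k, k) \<in> le F"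
    and le_trans: "(k, l) \<in> le F \<Longrightarrow> (l, m) \<in> le F \<Longrightarrow> (k, m) \<in> le F"
    and le_antisym: "(k, l) \<in> le F \<Longrightarrow> (l, k) \<in> le F \<Longrightarrow> k = l"
    and le_worlds: "(k, l) \<in> le F \<Longrightarrow> k \<in> worlds F \<and> l \<in> worlds F"
  using assms unfolding int_frame_def partial_order_on_def preorder_on_def
  by (auto dest: refl_onD transD antisymD)

lemma int_model_frame: "int_model M \<Longrightarrow> int_frame M"
  by (simp add: int_model_def)

lemma int_forces_persistent:
  assumes "int_model M" "(k, k') \<in> le M" "int_forces M k A"
  shows "int_forces M k' A"
  using assms(3)
proof (induction A)
  case (Var p)
  then show ?case
    using assms(1,2) unfolding int_model_def by auto
next
  case (Imp A B)
  have "(k, l) \<in> le M" if "(k', l) \<in> le M" for l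
    using le_trans[OF int_model_frame[OF assms(1)] assms(2) that] .
  with Imp.prems show ?case by simp
qed auto

lemma IPC_sound:
  assumes "int_model M" "\<turnstile>\<^sub>I\<^sub>P\<^sub>C A" "k \<in> worlds M"
  shows "int_forces M k A"
proof -
  have "int_frame M"
    using assms(1) by (simp add: int_model_def)
  note ord = le_refl[OF this] le_trans[OF this] and pers = int_forces_persistent[OF assms(1)]
  show ?thesis
    using assms(2,3)
  proof (induction arbitrary: k rule: IPC.induct)
    case (K A B)
    then show ?case using pers by auto
  next
    case (S A B C)
    then show ?case using ord by simp
  next
    case (AndI A B)
    then show ?case using pers by auto
  next
    case (OrE A C B)
    then show ?case using ord by simp
  next
    case (MP A B)
    then show ?case using ord by auto
  qed auto
qed


section \<open>Generation forcing and the induced model\<close>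

context
  fixes G :: "('w, 'v) model frame"
  assumes G: "G \<in> generation_structures"
begin

section \<open>Orders and valuations inside a generation structure\<close>

lemma gs_frame: "int_frame G"
  using G by (simp add: generation_structures_def)

lemma gs_worlds:
  assumes "W \<in> worlds G"
  shows "W \<in> fin_sf_models" "int_model W" "int_frame W" "worlds W \<noteq> {}"
proof -
  show "W \<in> fin_sf_models"
    using assms G unfolding generation_structures_def by blast
  then show "int_model W"
    unfolding fin_sf_models_def by blast
  then show "int_frame W"
    unfolding int_model_def by blast
  then show "worlds W \<noteq> {}"
    unfolding int_frame_def by blast
qed

text \<open>The generation order compares the orders of \<open>W\<close> and \<open>W'\<close> on
  worlds of \<open>W\<close> only. As \<open>le W\<close> is confined to these worlds, this yields a
  genuine inclusion of relations.\<close>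

lemma gs_leD:
  assumes "(W, W') \<in> le G"
  shows "W \<in> worlds G" "W' \<in> worlds G" "worlds W \<subseteq> worlds W'" "le W \<subseteq> le W'" "val W p \<subseteq> val W' p"
proof -
  show *: "W \<in> worlds G" "W' \<in> worlds G"
    using le_worlds[OF gs_frame assms] by auto
  have "worlds W \<subseteq> worlds W' \<and>
      (\<forall>k\<in>worlds W. \<forall>k'\<in>worlds W. (k, k') \<in> le W \<longleftrightarrow> (k, k') \<in> le W') \<and> (\<forall>p. val W p \<subseteq> val W' p)"
    using * assms G unfolding generation_structures_def generation_order_def by blast
  then show "worlds W \<subseteq> worlds W'" "val W p \<subseteq> val W' p" and "le W \<subseteq> le W'"
    using le_worlds[OF gs_worlds(3)[OF *(1)]] by (blast, blast, metis subrelI)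
qed

text \<open>Persistence along both orders at once. For an implication no induction hypothesis is
  used: its clause already quantifies over all later models and worlds, so transitivity of both
  orders suffices.\<close>

lemma gen_forces_persistent:
  assumes "(W, W') \<in> le G" "(k, k') \<in> le W'" "gen_forces G W k A"
  shows "gen_forces G W' k' A"
  using assms(3)
proof (induction A)
  case (Var p)
  then show ?case
    using assms(2) gs_leD(5)[OF assms(1)] gs_worlds(2)[OF gs_leD(2)[OF assms(1)]]
    unfolding int_model_def gen_forces.simps by blast
next
  case (Imp A B)
  show ?case
    unfolding gen_forces.simps
  proof (intro ballI impI)
    fix V l
    assume V: "V \<in> worlds G" "(W', V) \<in> le G" "l \<in> worlds V" "(k', l) \<in> le V" "gen_forces G V l A"
    have "(W, V) \<in> le G"
      using assms(1) V(2) by (rule le_trans[OF gs_frame])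
    moreover have "(k, l) \<in> le V"
      using assms(2) V(2,4) gs_leD(4) le_trans[OF gs_worlds(3)[OF V(1)]] by blast
    ultimately show "\<exists>m\<in>worlds V. (l, m) \<in> le V \<and> gen_forces G V m B"
      using Imp.prems V by auto
  qed
qed auto

lemma gen_forces_persistent_world:
  "W \<in> worlds G \<Longrightarrow> (k, k') \<in> le W \<Longrightarrow> gen_forces G W k A \<Longrightarrow> gen_forces G W k' A"
  using gen_forces_persistent le_refl[OF gs_frame] by blast

text \<open>For variables this is the defining condition of a strict finitistic model. For a
  conjunction, climb once for each conjunct and carry the first one along by persistence. The model
  varies in the induction because an implication refers to later models.\<close>

lemma gen_forces_prevalent:
  assumes "W \<in> worlds G" "k \<in> worlds W" "gen_forces G W k A" "l \<in> worlds W"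
  shows "\<exists>l'\<in>worlds W. (l, l') \<in> le W \<and> gen_forces G W l' A"
  using assms
proof (induction A arbitrary: W k l)
  case (Var p)
  then show ?case
    using gs_worlds(1)[of W] unfolding fin_sf_models_def by auto
next
  case (And A B)
  then obtain l1 where l1: "l1 \<in> worlds W" "(l, l1) \<in> le W" "gen_forces G W l1 A"
    by (metis gen_forces.simps(3))
  with And obtain l2 where "l2 \<in> worlds W" "(l1, l2) \<in> le W" "gen_forces G W l2 B"
    by (metis gen_forces.simps(3))
  with l1 And.prems(1) show ?case
    using gen_forces_persistent_world le_trans[OF gs_worlds(3)] by (metis gen_forces.simps(3))
next
  case (Or A B)
  then show ?case by (metis gen_forces.simps(4))
next
  case (Imp A B)
  \<comment> \<open>The implication even holds at \<open>l\<close> itself. The hypothesis for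
    \<open>A\<close> moves its truth from \<open>m\<close> to a world above \<open>k\<close>, where
    the implication applies; the hypothesis for \<open>B\<close> moves the result back above
    \<open>m\<close>.\<close>
  have "gen_forces G W l (A \<^bold>\<rightarrow> B)"
    unfolding gen_forces.simps
  proof (intro ballI impI)
    fix V m
    assume V: "V \<in> worlds G" "(W, V) \<in> le G" and m: "m \<in> worlds V" "gen_forces G V m A"
    have "k \<in> worlds V"
      using V(2) Imp.prems(2) gs_leD(3) by blast
    then obtain k1 where "k1 \<in> worlds V" "(k, k1) \<in> le V" "gen_forces G V k1 A"
      using Imp.IH(1)[OF V(1) m] by blast
    then obtain k2 where "k2 \<in> worlds V" "gen_forces G V k2 B"
      using Imp.prems(3) V by auto
    then show "\<exists>m'\<in>worlds V. (m, m') \<in> le V \<and> gen_forces G V m' B"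
      using Imp.IH(2)[OF V(1) _ _ m(1)] by blast
  qed
  then show ?case
    using Imp.prems(1,4) le_refl[OF gs_worlds(3)] by blast
qed simp

text \<open>The right-hand side does not mention \<open>k\<close>: by prevalence, truth of
  \<open>A\<close> somewhere in \<open>V\<close> can be moved above \<open>k\<close>, and truth of
  \<open>B\<close> above any given world. It is the intuitionistic clause for implication, read for
  "forced somewhere".\<close>

lemma gen_forces_Imp_iff:
  assumes "W \<in> worlds G" "k \<in> worlds W"
  shows "gen_forces G W k (A \<^bold>\<rightarrow> B) \<longleftrightarrow>
    (\<forall>V. (W, V) \<in> le G \<longrightarrow> (\<exists>l\<in>worlds V. gen_forces G V l A) \<longrightarrow> (\<exists>l\<in>worlds V. gen_forces G V l B))"
    (is "?L \<longleftrightarrow> ?R")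
proof
  assume L: ?L
  show ?R
  proof (intro allI impI)
    fix V assume V: "(W, V) \<in> le G" "\<exists>l\<in>worlds V. gen_forces G V l A"
    then have "V \<in> worlds G" "k \<in> worlds V"
      using assms gs_leD by blast+
    then obtain l where "l \<in> worlds V" "(k, l) \<in> le V" "gen_forces G V l A"
      using V(2) gen_forces_prevalent by blast
    then show "\<exists>l\<in>worlds V. gen_forces G V l B"
      using L V(1) \<open>V \<in> worlds G\<close> by auto
  qed
next
  assume ?R
  then show ?L
    unfolding gen_forces.simps using gen_forces_prevalent by meson
qed

lemma int_forces_induced_iff:
  "W \<in> worlds G \<Longrightarrow> int_forces (induced_model G) W A \<longleftrightarrow> (\<exists>k\<in>worlds W. gen_forces G W k A)"
proof (induction A arbitrary: W)
  case (And A B)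
  \<comment> \<open>The conjuncts may be forced at different worlds. Prevalence finds a world above
    \<open>k\<close> forcing \<open>B\<close>, and \<open>A\<close> persists to it.\<close>
  have "\<exists>m\<in>worlds W. gen_forces G W m (A \<^bold>\<and> B)"
    if "k \<in> worlds W" "gen_forces G W k A" "l \<in> worlds W" "gen_forces G W l B" for k l
    using gen_forces_prevalent[OF And.prems that(3,4,1)] gen_forces_persistent_world[OF And.prems]
      that by auto
  with And show ?case by auto
next
  case (Imp A B)
  obtain k where k: "k \<in> worlds W"
    using gs_worlds(4)[OF Imp.prems] by blast
  have "int_forces (induced_model G) W (A \<^bold>\<rightarrow> B) \<longleftrightarrow> gen_forces G W l (A \<^bold>\<rightarrow> B)"
    if "l \<in> worlds W" for l
    using Imp.IH gs_leD(2)
    unfolding gen_forces_Imp_iff[OF Imp.prems that] by (auto simp: induced_model_def)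
  with k show ?case by blast
qed (auto simp: induced_model_def)

lemma int_model_induced: "int_model (induced_model G)"
  using gs_frame gs_leD(2,3,5)
  by (fastforce simp: int_model_def int_frame_def induced_model_def)

text \<open>Induction on the derivation breaks at modus ponens, which in generation forcing gives
  the conclusion only at some later world. Hence the induction on the formula, with provability as
  premise.\<close>

lemma IPC_imp_gen_forces:
  assumes "\<turnstile>\<^sub>I\<^sub>P\<^sub>C A" "W \<in> worlds G" "k \<in> worlds W"
  shows "gen_forces G W k A"
proof -
  \<comment> \<open>Soundness in the induced model supplies one forcing world. This is enough for
    implications, whose forcing does not depend on the world.\<close>
  have induced: "\<exists>k\<in>worlds W. gen_forces G W k B" if "\<turnstile>\<^sub>I\<^sub>P\<^sub>C B" for B
    using IPC_sound[OF int_model_induced that] assms(2) int_forces_induced_iff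
    by (simp add: induced_model_def)
  show ?thesis
    using assms(1)
  proof (induction A rule: form.induct)
    case (Var p)
    then show ?case using IPC_imp_slash by fastforce
  next
    case Bot
    then show ?case using IPC_imp_slash by fastforce
  next
    case (And A B)
    then show ?case by (auto intro: IPC.MP IPC.AndE1 IPC.AndE2)
  next
    case (Or A B)
    then show ?case using IPC_disjunction_property by auto
  next
    case (Imp A B)
    from induced[OF Imp.prems] show ?case
      using gen_forces_Imp_iff[OF assms(2)] assms(3) by blast
  qed
qed

end

lemma gen_valid_imp_int_valid:
  fixes G :: "('w, 'v) model frame"
  assumes "gen_valid (generation_structures :: ('w, 'v) model frame set) A"
    and "G \<in> generation_structures"
  shows "int_valid (induced_model G) A"
  unfolding int_valid_def
proof
  fix W assume "W \<in> worlds (induced_model G)"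
  then have W: "W \<in> worlds G"
    by (simp add: induced_model_def)
  obtain k where "k \<in> worlds W"
    using W gs_worlds(4)[OF assms(2)] by blast
  moreover from this have "gen_forces G W k A"
    using assms W unfolding gen_valid_def by blast
  ultimately show "int_forces (induced_model G) W A"
    using int_forces_induced_iff[OF assms(2) W] by blast
qed


section \<open>Tree models as induced models\<close>

text \<open>The map \<open>f\<close> names nodes by elements of the prescribed world type. The
  valuation is all or nothing on each chain.\<close>

definition chain_model :: "('a, 'v) model \<Rightarrow> ('a \<Rightarrow> 'w) \<Rightarrow> 'a \<Rightarrow> ('w, 'v) model" where
  "chain_model M f t =
     \<lparr>worlds = f ` {s. (s, t) \<in> le M},
      le = {(f r, f s) |r s. (r, s) \<in> le M \<and> (s, t) \<in> le M},
      val = (\<lambda>p. if t \<in> val M p then f ` {s. (s, t) \<in> le M} else {})\<rparr>"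

definition chain_structure :: "('a, 'v) model \<Rightarrow> ('a \<Rightarrow> 'w) \<Rightarrow> ('w, 'v) model frame" where
  "chain_structure M f =
     \<lparr>worlds = chain_model M f ` worlds M,
      le = {(chain_model M f s, chain_model M f t) |s t. (s, t) \<in> le M}\<rparr>"

text \<open>An elementwise form of the frame conditions, used to check the three kinds of frames
  built below. Finiteness and comparability may range over all \<open>k\<close>, because the order
  is confined to the worlds and nothing lies below a non-world.\<close>

lemma int_frame_iff:
  "int_frame F \<longleftrightarrow>
     le F \<subseteq> worlds F \<times> worlds F \<and>
     (\<forall>k\<in>worlds F. (k, k) \<in> le F) \<and>
     (\<forall>k l m. (k, l) \<in> le F \<longrightarrow> (l, m) \<in> le F \<longrightarrow> (k, m) \<in> le F) \<and>
     (\<forall>k l. (k, l) \<in> le F \<longrightarrow> (l, k) \<in> le F \<longrightarrow> k = l) \<and>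
     (\<exists>r\<in>worlds F. \<forall>k\<in>worlds F. (r, k) \<in> le F) \<and>
     (\<forall>k. finite {l. (l, k) \<in> le F}) \<and>
     (\<forall>k l m. (l, k) \<in> le F \<longrightarrow> (m, k) \<in> le F \<longrightarrow> (l, m) \<in> le F \<or> (m, l) \<in> le F)"
  (is "_ \<longleftrightarrow> ?R")
proof
  assume F: "int_frame F"
  have below: "{l. (l, k) \<in> le F} = {l \<in> worlds F. (l, k) \<in> le F}" for k
    using le_worlds[OF F] by auto
  have below_empty: "k \<notin> worlds F \<Longrightarrow> {l. (l, k) \<in> le F} = {}" for k
    using le_worlds[OF F] by auto
  have fin: "finite {l. (l, k) \<in> le F}" for k
    using F below[of k] below_empty[of k] unfolding int_frame_def by (cases "k \<in> worlds F") auto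
  have ch: "(l, m) \<in> le F \<or> (m, l) \<in> le F" if "(l, k) \<in> le F" "(m, k) \<in> le F" for k l m
  proof -
    have "{l \<in> worlds F. (l, k) \<in> le F} \<in> Chains (le F)"
      using F le_worlds[OF F that(1)] unfolding int_frame_def by blast
    then show ?thesis
      using that le_worlds[OF F] unfolding Chains_def by blast
  qed
  have root: "\<exists>r\<in>worlds F. \<forall>k\<in>worlds F. (r, k) \<in> le F"
    using F unfolding int_frame_def by blast
  have sub: "le F \<subseteq> worlds F \<times> worlds F"
    using le_worlds[OF F] by auto
  show ?R
    by (intro conjI allI ballI impI sub root fin)
      (use ch le_refl[OF F] le_trans[OF F] le_antisym[OF F] in metis)+
next
  assume ?R
  then have R: "le F \<subseteq> worlds F \<times> worlds F" "\<And>k. k \<in> worlds F \<Longrightarrow> (k, k) \<in> le F"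
    "\<And>k l m. (k, l) \<in> le F \<Longrightarrow> (l, m) \<in> le F \<Longrightarrow> (k, m) \<in> le F"
    "\<And>k l. (k, l) \<in> le F \<Longrightarrow> (l, k) \<in> le F \<Longrightarrow> k = l"
    "\<exists>r\<in>worlds F. \<forall>k\<in>worlds F. (r, k) \<in> le F"
    "\<And>k. finite {l. (l, k) \<in> le F}"
    "\<And>k l m. (l, k) \<in> le F \<Longrightarrow> (m, k) \<in> le F \<Longrightarrow> (l, m) \<in> le F \<or> (m, l) \<in> le F"
    by meson+
  have "partial_order_on (worlds F) (le F)"
    unfolding partial_order_on_def preorder_on_def
    by (intro conjI refl_onI transI antisymI R(1)) (metis R(2-4))+
  moreover have "{l \<in> worlds F. (l, k) \<in> le F} \<in> Chains (le F)" for k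
    using R(7) by (auto simp: Chains_def)
  ultimately show "int_frame F"
    unfolding int_frame_def using R(5,6) by (auto intro: finite_subset[OF _ R(6)])
qed

context
  fixes M :: "('a, 'v) model" and f :: "'a \<Rightarrow> 'w"
  assumes M: "int_model M" and f: "inj_on f (worlds M)"
begin

section \<open>Chains in a tree model\<close>

lemma tree_frame: "int_frame M"
  using M by (simp add: int_model_def)

lemmas tree_order = le_refl[OF tree_frame] le_trans[OF tree_frame] le_antisym[OF tree_frame]
  le_worlds[OF tree_frame]

lemma tree_chain: "(r, t) \<in> le M \<Longrightarrow> (s, t) \<in> le M \<Longrightarrow> (r, s) \<in> le M \<or> (s, r) \<in> le M"
  and tree_finite: "finite {s. (s, t) \<in> le M}"
  using tree_frame unfolding int_frame_iff by blast+

lemma tree_inj: "s \<in> worlds M \<Longrightarrow> t \<in> worlds M \<Longrightarrow> f s = f t \<longleftrightarrow> s = t"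
  using f by (auto dest: inj_onD)

text \<open>Since \<open>s\<close> belongs to its own chain, inclusion of the chains puts
  \<open>s\<close> below \<open>t\<close> by injectivity of \<open>f\<close>. The tree order is thus
  read off from the sets of worlds, and distinct nodes get distinct models.\<close>

lemma chain_model_worlds_mono_iff:
  assumes "s \<in> worlds M" "t \<in> worlds M"
  shows "worlds (chain_model M f s) \<subseteq> worlds (chain_model M f t) \<longleftrightarrow> (s, t) \<in> le M"
proof
  assume "worlds (chain_model M f s) \<subseteq> worlds (chain_model M f t)"
  then have "f s \<in> f ` {r. (r, t) \<in> le M}"
    using tree_order(1)[OF assms(1)] by (auto simp: chain_model_def)
  then show "(s, t) \<in> le M"
    using tree_inj assms tree_order(4) by auto
qed (use tree_order in \<open>auto simp: chain_model_def\<close>)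

lemma chain_model_eq_iff:
  assumes "s \<in> worlds M" "t \<in> worlds M"
  shows "chain_model M f s = chain_model M f t \<longleftrightarrow> s = t"
  using chain_model_worlds_mono_iff[OF assms] chain_model_worlds_mono_iff[OF assms(2,1)]
    tree_order(3) by auto

lemma chain_model_le_iff:
  assumes "r \<in> worlds M" "s \<in> worlds M"
  shows "(f r, f s) \<in> le (chain_model M f t) \<longleftrightarrow> (r, s) \<in> le M \<and> (s, t) \<in> le M"
  using assms tree_inj tree_order(4) by (auto simp: chain_model_def)

lemma chain_structure_le_iff:
  assumes "s \<in> worlds M" "t \<in> worlds M"
  shows "(chain_model M f s, chain_model M f t) \<in> le (chain_structure M f) \<longleftrightarrow> (s, t) \<in> le M"
  using assms chain_model_eq_iff tree_order(4) by (fastforce simp: chain_structure_def)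

lemma chain_frame:
  assumes "t \<in> worlds M"
  shows "int_frame (chain_model M f t)"
proof -
  let ?C = "chain_model M f t"
  have le_cases: "\<exists>r s. k = f r \<and> l = f s \<and> r \<in> worlds M \<and> s \<in> worlds M \<and> (r, s) \<in> le M \<and> (s, t) \<in> le M"
    if "(k, l) \<in> le ?C" for k l
    using that tree_order(4) by (fastforce simp: chain_model_def)
  have worlds_iff: "f s \<in> worlds ?C \<longleftrightarrow> (s, t) \<in> le M" if "s \<in> worlds M" for s
    using that tree_inj tree_order(4) by (auto simp: chain_model_def)
  have worlds_cases: "\<exists>s. k = f s \<and> s \<in> worlds M \<and> (s, t) \<in> le M" if "k \<in> worlds ?C" for k
    using that tree_order(4) by (auto simp: chain_model_def)
  obtain r where r: "r \<in> worlds M" "\<forall>k\<in>worlds M. (r, k) \<in> le M"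
    using tree_frame unfolding int_frame_def by blast
  have sub: "le ?C \<subseteq> worlds ?C \<times> worlds ?C"
  proof clarify
    fix k l assume "(k, l) \<in> le ?C"
    from le_cases[OF this] show "k \<in> worlds ?C \<and> l \<in> worlds ?C"
      using worlds_iff tree_order(2) by metis
  qed
  have fin: "finite (worlds ?C)"
    using tree_finite by (simp add: chain_model_def)
  have finb: "finite {l. (l, k) \<in> le ?C}" for k
    using sub by (auto intro: finite_subset[OF _ fin])
  have refl: "(k, k) \<in> le ?C" if "k \<in> worlds ?C" for k
    using worlds_cases[OF that] chain_model_le_iff tree_order(1) by auto
  have trans: "(k, m) \<in> le ?C" if "(k, l) \<in> le ?C" "(l, m) \<in> le ?C" for k l m
    using le_cases[OF that(1)] le_cases[OF that(2)] tree_inj tree_order(2) chain_model_le_iff by metis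
  have antisym: "k = l" if "(k, l) \<in> le ?C" "(l, k) \<in> le ?C" for k l
    using le_cases[OF that(1)] le_cases[OF that(2)] tree_inj tree_order(3) by metis
  have chain: "(l, m) \<in> le ?C \<or> (m, l) \<in> le ?C" if "(l, k) \<in> le ?C" "(m, k) \<in> le ?C" for k l m
  proof -
    have "l \<in> worlds ?C" "m \<in> worlds ?C"
      using sub that by auto
    then obtain l' m' where "l = f l'" "l' \<in> worlds M" "(l', t) \<in> le M"
      "m = f m'" "m' \<in> worlds M" "(m', t) \<in> le M"
      using worlds_cases by meson
    then show ?thesis
      using tree_chain chain_model_le_iff by auto
  qed
  \<comment> \<open>Every chain starts at the root of the tree.\<close>
  have "f r \<in> worlds ?C" "\<forall>k\<in>worlds ?C. (f r, k) \<in> le ?C"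
    using r assms worlds_iff worlds_cases chain_model_le_iff by blast+
  then show ?thesis
    unfolding int_frame_iff using sub refl trans antisym finb chain by blast
qed

text \<open>Prevalence is immediate: a variable true somewhere in the chain is true at each
  \<open>l\<close>, so \<open>l\<close> is its own witness. Finiteness of the chain comes from
  finiteness of the set below \<open>t\<close>.\<close>

lemma chain_model_fin_sf:
  assumes "t \<in> worlds M" "finite {p. t \<in> val M p}"
  shows "chain_model M f t \<in> fin_sf_models"
proof -
  let ?C = "chain_model M f t"
  have val: "val ?C p = (if t \<in> val M p then worlds ?C else {})" for p
    by (simp add: chain_model_def)
  note frame = chain_frame[OF assms(1)]
  have "int_model ?C"
    using frame le_worlds[OF frame] by (auto simp: int_model_def val)
  moreover have "finite (worlds ?C)"
    using tree_finite by (simp add: chain_model_def)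
  moreover have "finite {p. k \<in> val ?C p}" for k
    by (rule finite_subset[OF _ assms(2)]) (auto simp: val)
  ultimately show ?thesis
    using le_refl[OF frame] by (auto simp: fin_sf_models_def val)
qed

text \<open>Inclusion of worlds recovers the tree order. Conversely, for \<open>s\<close> below
  \<open>t\<close> both chains carry the order of \<open>M\<close>, and a variable true at
  \<open>s\<close> stays true at \<open>t\<close>.\<close>

lemma chain_structure_generation_order: "generation_order (chain_structure M f)"
proof -
  have "(chain_model M f s, chain_model M f t) \<in> le (chain_structure M f) \<longleftrightarrow>
      worlds (chain_model M f s) \<subseteq> worlds (chain_model M f t) \<and>
      (\<forall>k\<in>worlds (chain_model M f s). \<forall>k'\<in>worlds (chain_model M f s).
        (k, k') \<in> le (chain_model M f s) \<longleftrightarrow> (k, k') \<in> le (chain_model M f t)) \<and>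
      (\<forall>p. val (chain_model M f s) p \<subseteq> val (chain_model M f t) p)" (is "_ \<longleftrightarrow> ?w \<and> ?l \<and> ?v")
    if st: "s \<in> worlds M" "t \<in> worlds M" for s t
  proof -
    have ?l if "(s, t) \<in> le M"
    proof (intro ballI)
      fix k k' assume "k \<in> worlds (chain_model M f s)" "k' \<in> worlds (chain_model M f s)"
      then obtain r r' where "k = f r" "k' = f r'" "(r, s) \<in> le M" "(r', s) \<in> le M"
        by (auto simp: chain_model_def)
      then show "(k, k') \<in> le (chain_model M f s) \<longleftrightarrow> (k, k') \<in> le (chain_model M f t)"
        using that tree_order(2,4) chain_model_le_iff by metis
    qed
    moreover have ?v if "(s, t) \<in> le M"
    proof -
      have "t \<in> val M p" if "s \<in> val M p" for p
        using M that \<open>(s, t) \<in> le M\<close> unfolding int_model_def by blast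
      moreover have "{r. (r, s) \<in> le M} \<subseteq> {r. (r, t) \<in> le M}"
        using that tree_order(2) by blast
      ultimately show ?thesis
        by (auto simp: chain_model_def)
    qed
    ultimately show ?thesis
      using chain_structure_le_iff[OF st] chain_model_worlds_mono_iff[OF st] by blast
  qed
  then show ?thesis
    by (simp add: generation_order_def chain_structure_def)
qed

text \<open>Sending a node to its chain model is an order isomorphism from \<open>M\<close>, so each
  frame condition is transported.\<close>

lemma chain_structure_frame: "int_frame (chain_structure M f)"
proof -
  let ?C = "chain_model M f" and ?G = "chain_structure M f"
  have le_cases: "\<exists>s t. W = ?C s \<and> V = ?C t \<and> s \<in> worlds M \<and> t \<in> worlds M \<and> (s, t) \<in> le M"
    if "(W, V) \<in> le ?G" for W V
    using that tree_order(4) by (fastforce simp: chain_structure_def)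
  have worlds_cases: "\<exists>s. W = ?C s \<and> s \<in> worlds M" if "W \<in> worlds ?G" for W
    using that by (auto simp: chain_structure_def)
  have worldsI: "?C s \<in> worlds ?G" if "s \<in> worlds M" for s
    using that by (auto simp: chain_structure_def)
  obtain r where r: "r \<in> worlds M" "\<forall>k\<in>worlds M. (r, k) \<in> le M"
    using tree_frame unfolding int_frame_def by blast
  have sub: "le ?G \<subseteq> worlds ?G \<times> worlds ?G"
    using le_cases worldsI by (metis SigmaI subrelI)
  have refl: "(W, W) \<in> le ?G" if "W \<in> worlds ?G" for W
    using worlds_cases[OF that] chain_structure_le_iff tree_order(1) by auto
  have trans: "(U, W) \<in> le ?G" if "(U, V) \<in> le ?G" "(V, W) \<in> le ?G" for U V W
    using le_cases[OF that(1)] le_cases[OF that(2)] chain_model_eq_iff tree_order(2)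
      chain_structure_le_iff by metis
  have antisym: "V = W" if "(V, W) \<in> le ?G" "(W, V) \<in> le ?G" for V W
    using le_cases[OF that(1)] le_cases[OF that(2)] chain_model_eq_iff tree_order(3) by metis
  have finb: "finite {V. (V, W) \<in> le ?G}" for W
  proof (cases "W \<in> worlds ?G")
    case True
    then obtain t where t: "W = ?C t" "t \<in> worlds M"
      using worlds_cases by blast
    have "{V. (V, W) \<in> le ?G} \<subseteq> ?C ` {s. (s, t) \<in> le M}"
    proof clarify
      fix V assume "(V, W) \<in> le ?G"
      from le_cases[OF this] show "V \<in> ?C ` {s. (s, t) \<in> le M}"
        using t chain_model_eq_iff by blast
    qed
    then show ?thesis
      using tree_finite by (blast intro: finite_subset)
  next
    case False
    then have "{V. (V, W) \<in> le ?G} = {}"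
      using sub by auto
    then show ?thesis by simp
  qed
  have chain: "(U, V) \<in> le ?G \<or> (V, U) \<in> le ?G" if "(U, W) \<in> le ?G" "(V, W) \<in> le ?G" for U V W
    using le_cases[OF that(1)] le_cases[OF that(2)] chain_model_eq_iff tree_chain
      chain_structure_le_iff by metis
  have "?C r \<in> worlds ?G" "\<forall>W\<in>worlds ?G. (?C r, W) \<in> le ?G"
    using r worldsI worlds_cases chain_structure_le_iff by blast+
  then show ?thesis
    unfolding int_frame_iff using sub refl trans antisym finb chain by blast
qed

lemma chain_structure_in_generation_structures:
  assumes "countable (worlds M)" "\<And>t. t \<in> worlds M \<Longrightarrow> finite {p. t \<in> val M p}"
  shows "chain_structure M f \<in> generation_structures"
proof -
  have "worlds (chain_structure M f) \<subseteq> fin_sf_models" "countable (worlds (chain_structure M f))"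
    using assms chain_model_fin_sf by (auto simp: chain_structure_def)
  then show ?thesis
    using chain_structure_generation_order chain_structure_frame
    by (simp add: generation_structures_def)
qed

lemma int_forces_chain_structure_iff:
  "t \<in> worlds M \<Longrightarrow>
   int_forces (induced_model (chain_structure M f)) (chain_model M f t) A \<longleftrightarrow> int_forces M t A"
proof (induction A arbitrary: t)
  case (Var p)
  \<comment> \<open>The chain of \<open>t\<close> is nonempty, as it contains \<open>t\<close>;
    hence a variable holds somewhere in it exactly when it holds at \<open>t\<close>.\<close>
  then have "(t, t) \<in> le M"
    by (rule tree_order)
  with Var show ?case
    by (auto simp: induced_model_def chain_structure_def chain_model_def)
next
  case (Imp A B)
  have "worlds (induced_model (chain_structure M f)) = chain_model M f ` worlds M"
    "le (induced_model (chain_structure M f)) = le (chain_structure M f)"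
    by (simp_all add: induced_model_def chain_structure_def)
  with Imp chain_structure_le_iff[OF Imp.prems] show ?case
    by simp
qed auto

end


section \<open>Completeness for countable trees\<close>

primrec subformulas :: "'v form \<Rightarrow> 'v form set" where
  "subformulas (Var p) = {Var p}"
| "subformulas \<^bold>\<bottom> = {\<^bold>\<bottom>}"
| "subformulas (A \<^bold>\<and> B) = insert (A \<^bold>\<and> B) (subformulas A \<union> subformulas B)"
| "subformulas (A \<^bold>\<or> B) = insert (A \<^bold>\<or> B) (subformulas A \<union> subformulas B)"
| "subformulas (A \<^bold>\<rightarrow> B) = insert (A \<^bold>\<rightarrow> B) (subformulas A \<union> subformulas B)"

lemma finite_subformulas: "finite (subformulas A)"
  by (induction A) auto

lemma subformulas_refl: "A \<in> subformulas A"
  by (cases A) auto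

text \<open>Closure and primeness are relative to \<Phi>, although derivations may leave \<Phi>. A
  finite \<Phi> therefore has only finitely many prime theories.\<close>

definition prime_theory :: "'v form set \<Rightarrow> 'v form set \<Rightarrow> bool" where
  "prime_theory \<Phi> \<Gamma> \<longleftrightarrow>
     \<Gamma> \<subseteq> \<Phi> \<and> (\<forall>A\<in>\<Phi>. \<Gamma> \<turnstile> A \<longrightarrow> A \<in> \<Gamma>) \<and> \<not> \<Gamma> \<turnstile> \<^bold>\<bottom> \<and>
     (\<forall>A\<in>\<Phi>. \<forall>B\<in>\<Phi>. A \<^bold>\<or> B \<in> \<Gamma> \<longrightarrow> A \<in> \<Gamma> \<or> B \<in> \<Gamma>)"

lemma prime_theory_iff: "prime_theory \<Phi> \<Gamma> \<Longrightarrow> A \<in> \<Phi> \<Longrightarrow> A \<in> \<Gamma> \<longleftrightarrow> \<Gamma> \<turnstile> A"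
  unfolding prime_theory_def by (blast intro: assm)

lemma prime_theory_Or:
  "prime_theory \<Phi> \<Gamma> \<Longrightarrow> A \<in> \<Phi> \<Longrightarrow> B \<in> \<Phi> \<Longrightarrow> A \<^bold>\<or> B \<in> \<Gamma> \<Longrightarrow> A \<in> \<Gamma> \<or> B \<in> \<Gamma>"
  unfolding prime_theory_def by blast

text \<open>Take a maximal subset of \<Phi> that contains \<Gamma> and does not derive
  \<open>A\<close>. Finiteness of \<Phi> provides it without Zorn's lemma.\<close>

lemma prime_extension:
  assumes "finite \<Phi>" "\<Gamma> \<subseteq> \<Phi>" "\<not> \<Gamma> \<turnstile> A"
  obtains \<Delta> where "prime_theory \<Phi> \<Delta>" "\<Gamma> \<subseteq> \<Delta>" "\<not> \<Delta> \<turnstile> A"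
proof -
  define S where "S = {\<Delta>. \<Gamma> \<subseteq> \<Delta> \<and> \<Delta> \<subseteq> \<Phi> \<and> \<not> \<Delta> \<turnstile> A}"
  have "finite S"
    by (rule finite_subset[of _ "Pow \<Phi>"]) (use assms in \<open>auto simp: S_def\<close>)
  moreover have "\<Gamma> \<in> S"
    using assms by (simp add: S_def)
  ultimately obtain \<Delta> where "\<Delta> \<in> S" and max: "\<And>X. X \<in> S \<Longrightarrow> \<Delta> \<subseteq> X \<Longrightarrow> \<Delta> = X"
    using finite_has_maximal2[of S \<Gamma>] by metis
  then have \<Delta>: "\<Gamma> \<subseteq> \<Delta>" "\<Delta> \<subseteq> \<Phi>" "\<not> \<Delta> \<turnstile> A"
    by (auto simp: S_def)
  \<comment> \<open>By maximality, any further formula of \<Phi> makes \<open>A\<close> derivable.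
    Closure then follows by cut and primeness by disjunction elimination; consistency holds since
    falsum would derive \<open>A\<close>.\<close>
  have ins: "insert B \<Delta> \<turnstile> A" if "B \<in> \<Phi>" "B \<notin> \<Delta>" for B
    using max[of "insert B \<Delta>"] \<Delta> that unfolding S_def by blast
  have "prime_theory \<Phi> \<Delta>"
    unfolding prime_theory_def
    using \<Delta> ins by (blast intro: derives_cut derives_BotE derives_OrE assm)
  with \<Delta> that show thesis by blast
qed

text \<open>Theories ordered by inclusion need not form a tree, so a node records a whole increasing
  path from \<Gamma>; its last entry is the theory true there. Repetitions are allowed.\<close>

definition unravelling :: "'v form set \<Rightarrow> 'v form set \<Rightarrow> ('v form set list, 'v) model" where
  "unravelling \<Phi> \<Gamma> =
     (let T = {xs. xs \<noteq> [] \<and> hd xs = \<Gamma> \<and> (\<forall>\<Delta>\<in>set xs. prime_theory \<Phi> \<Delta>) \<and> sorted_wrt (\<subseteq>) xs}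
      in \<lparr>worlds = T, le = {(xs, ys). xs \<in> T \<and> ys \<in> T \<and> prefix xs ys},
          val = (\<lambda>p. {xs \<in> T. Var p \<in> last xs})\<rparr>)"

section \<open>Properties of the tree of theories\<close>

lemma unravelling_worlds:
  "xs \<in> worlds (unravelling \<Phi> \<Gamma>) \<longleftrightarrow>
     xs \<noteq> [] \<and> hd xs = \<Gamma> \<and> (\<forall>\<Delta>\<in>set xs. prime_theory \<Phi> \<Delta>) \<and> sorted_wrt (\<subseteq>) xs"
  by (simp add: unravelling_def)

lemma unravelling_le:
  "(xs, ys) \<in> le (unravelling \<Phi> \<Gamma>) \<longleftrightarrow>
     xs \<in> worlds (unravelling \<Phi> \<Gamma>) \<and> ys \<in> worlds (unravelling \<Phi> \<Gamma>) \<and> prefix xs ys"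
  by (simp add: unravelling_def)

lemma unravelling_val:
  "xs \<in> val (unravelling \<Phi> \<Gamma>) p \<longleftrightarrow> xs \<in> worlds (unravelling \<Phi> \<Gamma>) \<and> Var p \<in> last xs"
  by (simp add: unravelling_def)

lemma sorted_wrt_prefix_last_mono:
  assumes "sorted_wrt (\<subseteq>) ys" "prefix xs ys" "xs \<noteq> []"
  shows "last xs \<subseteq> last ys"
proof -
  from assms(2) obtain zs where "ys = xs @ zs"
    by (auto simp: prefix_def)
  then show ?thesis
    using assms(1,3) by (cases "zs = []") (auto simp: sorted_wrt_append)
qed

lemma unravelling_last_mono:
  "(xs, ys) \<in> le (unravelling \<Phi> \<Gamma>) \<Longrightarrow> last xs \<subseteq> last ys"
  using sorted_wrt_prefix_last_mono by (auto simp: unravelling_le unravelling_worlds)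

lemma unravelling_last_prime:
  "xs \<in> worlds (unravelling \<Phi> \<Gamma>) \<Longrightarrow> prime_theory \<Phi> (last xs)"
  by (simp add: unravelling_worlds)

lemma unravelling_root: "prime_theory \<Phi> \<Gamma> \<Longrightarrow> [\<Gamma>] \<in> worlds (unravelling \<Phi> \<Gamma>)"
  by (simp add: unravelling_worlds)

lemma unravelling_int_model:
  assumes "prime_theory \<Phi> \<Gamma>"
  shows "int_model (unravelling \<Phi> \<Gamma>)"
proof -
  let ?M = "unravelling \<Phi> \<Gamma>"
  have "prefix [\<Gamma>] xs" if "xs \<in> worlds ?M" for xs
    using that by (cases xs) (auto simp: unravelling_worlds)
  then have root: "\<exists>r\<in>worlds ?M. \<forall>k\<in>worlds ?M. (r, k) \<in> le ?M"
    using unravelling_root[OF assms] by (auto simp: unravelling_le)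
  have fin: "finite {l. (l, k) \<in> le ?M}" for k
    by (rule finite_subset[of _ "set (prefixes k)"]) (auto simp: unravelling_le)
  have "int_frame ?M"
    unfolding int_frame_iff
    using root fin by (auto simp: unravelling_le dest: prefix_same_cases prefix_order.trans)
  moreover have "k' \<in> val ?M p" if "k \<in> val ?M p" "(k, k') \<in> le ?M" for p k k'
    using that unravelling_last_mono[OF that(2)] by (auto simp: unravelling_val unravelling_le)
  moreover have "val ?M p \<subseteq> worlds ?M" for p
    by (simp add: subset_iff unravelling_val)
  ultimately show ?thesis
    unfolding int_model_def by blast
qed

lemma unravelling_countable:
  assumes "finite \<Phi>"
  shows "countable (worlds (unravelling \<Phi> \<Gamma>))"
proof (rule countable_subset)
  show "worlds (unravelling \<Phi> \<Gamma>) \<subseteq> lists (Pow \<Phi>)"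
    by (auto simp: unravelling_worlds prime_theory_def dest!: bspec subsetD)
  show "countable (lists (Pow \<Phi>))"
    using assms by (simp add: countable_finite)
qed

text \<open>Needed because a strict finitistic model allows only finitely many variables at each
  world.\<close>

lemma unravelling_finite_val:
  assumes "finite \<Phi>"
  shows "finite {p. xs \<in> val (unravelling \<Phi> \<Gamma>) p}"
proof -
  have "Var ` {p. xs \<in> val (unravelling \<Phi> \<Gamma>) p} \<subseteq> \<Phi>"
    using unravelling_last_prime by (fastforce simp: unravelling_val prime_theory_def)
  then have "finite (Var ` {p. xs \<in> val (unravelling \<Phi> \<Gamma>) p})"
    using assms by (rule finite_subset)
  then show ?thesis
    by (rule finite_imageD) (simp add: inj_on_def)
qed

lemma truth_lemma:
  assumes "finite \<Phi>"
  shows "subformulas A \<subseteq> \<Phi> \<Longrightarrow> xs \<in> worlds (unravelling \<Phi> \<Gamma>) \<Longrightarrow>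
    int_forces (unravelling \<Phi> \<Gamma>) xs A \<longleftrightarrow> A \<in> last xs"
proof (induction A arbitrary: xs)
  case (Var p)
  then show ?case by (simp add: unravelling_val)
next
  case Bot
  then show ?case
    using unravelling_last_prime[OF Bot(2)] by (auto simp: prime_theory_def intro: assm)
next
  case (And A B)
  have "A \<in> \<Phi>" "B \<in> \<Phi>" "A \<^bold>\<and> B \<in> \<Phi>"
    using And.prems(1) subformulas_refl by auto
  then have "A \<^bold>\<and> B \<in> last xs \<longleftrightarrow> A \<in> last xs \<and> B \<in> last xs"
    using prime_theory_iff[OF unravelling_last_prime[OF And.prems(2)]] derives_And_iff by metis
  with And show ?case by simp
next
  case (Or A B)
  have "A \<in> \<Phi>" "B \<in> \<Phi>" "A \<^bold>\<or> B \<in> \<Phi>"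
    using Or.prems(1) subformulas_refl by auto
  then have "A \<^bold>\<or> B \<in> last xs \<longleftrightarrow> A \<in> last xs \<or> B \<in> last xs"
    using prime_theory_iff[OF unravelling_last_prime[OF Or.prems(2)]]
      prime_theory_Or[OF unravelling_last_prime[OF Or.prems(2)]] derives_OrI1 derives_OrI2 by metis
  with Or show ?case by simp
next
  case (Imp A B)
  let ?M = "unravelling \<Phi> \<Gamma>"
  have in_\<Phi>: "A \<in> \<Phi>" "B \<in> \<Phi>" "A \<^bold>\<rightarrow> B \<in> \<Phi>"
    using Imp.prems(1) subformulas_refl by auto
  have IH: "int_forces ?M ys A \<longleftrightarrow> A \<in> last ys" "int_forces ?M ys B \<longleftrightarrow> B \<in> last ys"
    if "ys \<in> worlds ?M" for ys
    using Imp.IH Imp.prems(1) that by auto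
  show ?case
  proof
    assume "A \<^bold>\<rightarrow> B \<in> last xs"
    then have "B \<in> last ys" if "(xs, ys) \<in> le ?M" "A \<in> last ys" for ys
    proof -
      have "last ys \<turnstile> B"
        using \<open>A \<^bold>\<rightarrow> B \<in> last xs\<close> that unravelling_last_mono by (blast intro: mp assm)
      moreover have "prime_theory \<Phi> (last ys)"
        using that(1) unfolding unravelling_le by (intro unravelling_last_prime) blast
      ultimately show ?thesis
        using in_\<Phi> by (simp add: prime_theory_def)
    qed
    with IH show "int_forces ?M xs (A \<^bold>\<rightarrow> B)" by simp
  next
    assume forces: "int_forces ?M xs (A \<^bold>\<rightarrow> B)"
    have prime: "prime_theory \<Phi> (last xs)"
      using Imp.prems(2) by (rule unravelling_last_prime)
    show "A \<^bold>\<rightarrow> B \<in> last xs"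
    proof (rule ccontr)
      assume "A \<^bold>\<rightarrow> B \<notin> last xs"
      \<comment> \<open>If \<open>B\<close> followed, the deduction theorem and closure within
        \<Phi> would put the implication into the last theory. A prime extension avoiding
        \<open>B\<close> is then appended as a new node that refutes the implication.\<close>
      then have "\<not> insert A (last xs) \<turnstile> B"
        using prime in_\<Phi> deduction unfolding prime_theory_def by blast
      then obtain \<Delta> where \<Delta>: "prime_theory \<Phi> \<Delta>" "insert A (last xs) \<subseteq> \<Delta>" "\<not> \<Delta> \<turnstile> B"
        using prime_extension[OF assms] prime in_\<Phi> unfolding prime_theory_def
        by (metis insert_subset)
      have xs: "xs \<noteq> []" "sorted_wrt (\<subseteq>) xs"
        using Imp.prems(2) by (auto simp: unravelling_worlds)
      \<comment> \<open>\<open>sorted_wrt\<close> compares the appended theory with every entry of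
        the list, not just with the last one.\<close>
      have "\<Theta> \<subseteq> last xs" if "\<Theta> \<in> set xs" for \<Theta>
      proof -
        obtain us vs where "xs = us @ \<Theta> # vs"
          using split_list \<open>\<Theta> \<in> set xs\<close> by metis
        then have "prefix (us @ [\<Theta>]) xs"
          by simp
        from sorted_wrt_prefix_last_mono[OF xs(2) this] show ?thesis
          by simp
      qed
      then have "xs @ [\<Delta>] \<in> worlds ?M"
        using Imp.prems(2) \<Delta>(1,2) by (fastforce simp: unravelling_worlds sorted_wrt_append)
      moreover from this have "(xs, xs @ [\<Delta>]) \<in> le ?M"
        using Imp.prems(2) by (simp add: unravelling_le)
      ultimately have "B \<in> \<Delta>"
        using forces IH \<Delta>(2) by auto
      with \<Delta>(3) show False by (blast intro: assm)
    qed
  qed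
qed

lemma induced_valid_imp_IPC:
  fixes A :: "'v form"
  assumes inf: "infinite (UNIV :: 'w set)"
    and valid: "\<And>G :: ('w, 'v) model frame. G \<in> generation_structures \<Longrightarrow> int_valid (induced_model G) A"
  shows "\<turnstile>\<^sub>I\<^sub>P\<^sub>C A"
proof (rule ccontr)
  assume "\<not> \<turnstile>\<^sub>I\<^sub>P\<^sub>C A"
  then have "\<not> {} \<turnstile> A"
    by (simp add: derives_empty_iff)
  let ?\<Phi> = "subformulas A"
  obtain \<Gamma> where \<Gamma>: "prime_theory ?\<Phi> \<Gamma>" "\<not> \<Gamma> \<turnstile> A"
    using prime_extension[OF finite_subformulas _ \<open>\<not> {} \<turnstile> A\<close>] by blast
  let ?M = "unravelling ?\<Phi> \<Gamma>"
  note M = unravelling_int_model[OF \<Gamma>(1)]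
    and countable = unravelling_countable[OF finite_subformulas]
    and root = unravelling_root[OF \<Gamma>(1)]
  obtain g :: "nat \<Rightarrow> 'w" where "inj g"
    using inf infinite_countable_subset by blast
  \<comment> \<open>The tree is countable and \<open>'w\<close> is infinite, so numbering the nodes
    and embedding the numbers names the nodes injectively.\<close>
  define f where "f = g \<circ> to_nat_on (worlds ?M)"
  have f: "inj_on f (worlds ?M)"
    unfolding f_def
    by (rule comp_inj_on[OF inj_on_to_nat_on[OF countable]])
      (use \<open>inj g\<close> in \<open>auto intro: inj_on_subset\<close>)
  have "chain_structure ?M f \<in> generation_structures"
    using countable unravelling_finite_val[OF finite_subformulas]
    by (rule chain_structure_in_generation_structures[OF M f])
  from valid[OF this]
  have "int_forces (induced_model (chain_structure ?M f)) (chain_model ?M f [\<Gamma>]) A"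
    using root by (simp add: int_valid_def induced_model_def chain_structure_def)
  then have "A \<in> \<Gamma>"
    using int_forces_chain_structure_iff[OF M f root] truth_lemma[OF finite_subformulas _ root]
    by simp
  with \<Gamma>(2) show False by (blast intro: assm)
qed

theorem proposition32:
  fixes A :: "'v::countable form"
  assumes "infinite (UNIV :: 'w set)"
  shows "(gen_valid (generation_structures :: ('w, 'v) model frame set) A \<longleftrightarrow>
           (\<forall>G \<in> (generation_structures :: ('w, 'v) model frame set). int_valid (induced_model G) A))
       \<and> ((\<forall>G \<in> (generation_structures :: ('w, 'v) model frame set). int_valid (induced_model G) A) \<longleftrightarrow>
           (\<turnstile>\<^sub>I\<^sub>P\<^sub>C A))"
proof -
  let ?G = "generation_structures :: ('w, 'v) model frame set"
  \<comment> \<open>The equivalences are proved as a cycle: (i) to (ii), (ii) to (iii), (iii) to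
    (i).\<close>
  have "\<forall>G\<in>?G. int_valid (induced_model G) A" if "gen_valid ?G A"
    using gen_valid_imp_int_valid[OF that] by blast
  moreover have "\<turnstile>\<^sub>I\<^sub>P\<^sub>C A" if "\<forall>G\<in>?G. int_valid (induced_model G) A"
    using that by (intro induced_valid_imp_IPC[OF assms]) blast
  moreover have "gen_valid ?G A" if "\<turnstile>\<^sub>I\<^sub>P\<^sub>C A"
    unfolding gen_valid_def using that by (intro ballI IPC_imp_gen_forces)
  ultimately show ?thesis by blast
qed

end
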